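(* Let $\varphi\in\Omega$ and $f\in\mathcal{S}(\mathbb{R}^2)$. Then for each $k\in\mathbb{N}_0$ and each $\theta$, $$\hat{b}^{(k)}(\theta):=\int_{-\infty}^\infty\widehat{R}_\varphi f(\theta,p)\,p^k\,dp=\sum_{j=0}^kC(k,j)\,c_j\,b^{(k-j)}(\theta),$$ where $c_j=(-1)^j\gamma_j(\varphi)$ and $\gamma_j(\varphi)=\int_{-\infty}^\infty\tau^j\varphi(\tau)\,d\tau$ for each $j\in\mathbb{N}_0$. That is, the value $\hat{b}^{(k)}(\theta)$ is a linear combination of $b^{(0)}(\theta),b^{(1)}(\theta),\ldots,b^{(k)}(\theta)$ for any $\theta$.
   Context: $\mathcal{S}(\mathbb{R}^2)$ is the Schwartz space, $\mathbb{N}_0=\{0,1,2,\dots\}$, and $C(k,j)=\frac{k!}{j!(k-j)!}$. For $\theta\in[0,2\pi]$ write $\omega=\omega(\theta)=(\cos\theta,\sin\theta)$, and let $p\in\mathbb{R}$. The Radon transform is $Rf(\theta,p)=\int_{\langle x,\omega\rangle=p}f(x)\,dm(x)$, where $dm$ is arc length measure on the line $\{x\in\mathbb{R}^2:\langle x,\omega\rangle=p\}$. Its moments are $$b^{(k)}(\theta):=\int_{-\infty}^\infty Rf(\theta,p)\,p^k\,dp.$$ A (positive) mollifier is a smooth, nonnegative, compactly supported integrable function $\varphi:\mathbb{R}\to\mathbb{R}$ such that (1) $\int_{-\infty}^\infty\varphi(t)\,dt=1$, and (2) with $\varphi_h(t)=\frac1h\varphi(t/h)$ and $u\ast\varphi_h(x)=\int_{\mathbb{R}}u(y)\varphi_h(x-y)\,dy$,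 one has $\|u\ast\varphi_h-u\|_{L^\infty(\mathbb{R})}\to0$ as $h\to0$ for bounded uniformly continuous $u$. It is symmetric if $\varphi(t)=g(|t|)$ for some infinitely differentiable $g:\mathbb{R}\to\mathbb{R}$. $\Omega$ is the set of positive symmetric mollifiers $\varphi$ such that $F_1(\varphi)(s)>0$ for all $s\in\mathbb{R}$, where $F_1f(s)=\frac1{\sqrt{2\pi}}\int_{-\infty}^\infty f(t)e^{-ist}\,dt$. For $\varphi\in\Omega$ and $f\in L^1(\mathbb{R}^2)$ the modified Radon transform is $\widehat{R}_\varphi f(\theta,p)=\int_{\mathbb{R}^2}\chi(x;\theta,p)f(x)\,dx$ with $\chi(x;\theta,p)=(\delta\ast\varphi)(\langle x,\omega\rangle-p)$, $\delta$ the delta function; that is, $\chi(x;\theta,p)=\varphi(\langle x,\omega\rangle-p)$. *)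

theory Defs
  imports "HOL-Analysis.Analysis" "HOL-Probability.Essential_Supremum"
begin

text \<open>The head of the list is the last partial derivative taken.\<close>

fun partials :: "'a::euclidean_space list \<Rightarrow> ('a \<Rightarrow> 'b::real_normed_vector) \<Rightarrow> 'a \<Rightarrow> 'b" where
  "partials [] f = f"
| "partials (b # bs) f = (\<lambda>x. frechet_derivative (partials bs f) (at x) b)"

text \<open>Infinite differentiability: every iterated partial derivative is Frechet differentiable
  everywhere, hence in particular continuous.\<close>

definition smooth :: "('a::euclidean_space \<Rightarrow> 'b::real_normed_vector) \<Rightarrow> bool" where
  "smooth f \<longleftrightarrow> (\<forall>bs. set bs \<subseteq> Basis \<longrightarrow> partials bs f differentiable_on UNIV)"

text \<open>Here \<^term>\<open>\<alpha>\<close> is a multi-index, and a list of basis vectors plays the role of the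
  multi-index of a derivative.\<close>

definition schwartz_space :: "('a::euclidean_space \<Rightarrow> 'b::real_normed_vector) set" where
  "schwartz_space = {f. smooth f \<and>
     (\<forall>(\<alpha> :: 'a \<Rightarrow> nat) bs. set bs \<subseteq> Basis \<longrightarrow>
        bounded (range (\<lambda>x. (\<Prod>b\<in>Basis. (x \<bullet> b) ^ \<alpha> b) *\<^sub>R partials bs f x)))}"

definition omega :: "real \<Rightarrow> real \<times> real" where
  "omega \<theta> = (cos \<theta>, sin \<theta>)"

text \<open>Arc length measure on the line \<open>\<langle>x, \<omega>\<rangle> = p\<close>, as the image of Lebesgue measure under
  the unit speed parametrisation of that line.\<close>

definition line_arc_length :: "real \<Rightarrow> real \<Rightarrow> (real \<times> real) measure" where
  "line_arc_length \<theta> p =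
     distr lborel borel (\<lambda>t. p *\<^sub>R omega \<theta> + t *\<^sub>R (- sin \<theta>, cos \<theta>))"

definition radon :: "(real \<times> real \<Rightarrow> complex) \<Rightarrow> real \<Rightarrow> real \<Rightarrow> complex" where
  "radon f \<theta> p = (LINT x:{x. x \<bullet> omega \<theta> = p}|line_arc_length \<theta> p. f x)"

definition radon_moment :: "(real \<Rightarrow> real \<Rightarrow> complex) \<Rightarrow> nat \<Rightarrow> real \<Rightarrow> complex" where
  "radon_moment T k \<theta> = (LINT p|lborel. T \<theta> p * of_real (p ^ k))"

definition dilate :: "real \<Rightarrow> (real \<Rightarrow> real) \<Rightarrow> real \<Rightarrow> real" where
  "dilate h \<phi> t = (1 / h) * \<phi> (t / h)"

definition convolve :: "(real \<Rightarrow> real) \<Rightarrow> (real \<Rightarrow> real) \<Rightarrow> real \<Rightarrow> real" where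
  "convolve u v x = (LINT y|lborel. u y * v (x - y))"

text \<open>The limit \<open>h \<rightarrow> 0\<close> is through positive \<open>h\<close>, since for negative \<open>h\<close> the
  dilation has integral \<open>-1\<close>.\<close>

definition positive_mollifier :: "(real \<Rightarrow> real) \<Rightarrow> bool" where
  "positive_mollifier \<phi> \<longleftrightarrow>
     smooth \<phi> \<and> (\<forall>t. 0 \<le> \<phi> t) \<and> compact (closure {t. \<phi> t \<noteq> 0}) \<and>
     integrable lborel \<phi> \<and> (LINT t|lborel. \<phi> t) = 1 \<and>
     (\<forall>u. bounded (range u) \<and> uniformly_continuous_on UNIV u \<longrightarrow>
        ((\<lambda>h. esssup lborel (\<lambda>x. ereal \<bar>convolve u (dilate h \<phi>) x - u x\<bar>)) \<longlongrightarrow> 0) (at_right 0))"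

definition symmetric_mollifier :: "(real \<Rightarrow> real) \<Rightarrow> bool" where
  "symmetric_mollifier \<phi> \<longleftrightarrow>
     positive_mollifier \<phi> \<and> (\<exists>g :: real \<Rightarrow> real. smooth g \<and> (\<forall>t. \<phi> t = g \<bar>t\<bar>))"

definition fourier1 :: "(real \<Rightarrow> real) \<Rightarrow> real \<Rightarrow> complex" where
  "fourier1 f s =
     of_real (1 / sqrt (2 * pi)) * (LINT t|lborel. of_real (f t) * exp (- \<i> * of_real s * of_real t))"

text \<open>For a complex number, being positive includes being real.\<close>

definition Omega :: "(real \<Rightarrow> real) set" where
  "Omega = {\<phi>. symmetric_mollifier \<phi> \<and>
     (\<forall>s. fourier1 \<phi> s \<in> \<real> \<and> 0 < Re (fourier1 \<phi> s))}"

definition chi :: "(real \<Rightarrow> real) \<Rightarrow> real \<times> real \<Rightarrow> real \<Rightarrow> real \<Rightarrow> real" where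
  "chi \<phi> x \<theta> p = \<phi> (x \<bullet> omega \<theta> - p)"

definition modified_radon ::
    "(real \<Rightarrow> real) \<Rightarrow> (real \<times> real \<Rightarrow> complex) \<Rightarrow> real \<Rightarrow> real \<Rightarrow> complex" where
  "modified_radon \<phi> f \<theta> p = (LINT x|lborel. of_real (chi \<phi> x \<theta> p) * f x)"

definition mollifier_moment :: "nat \<Rightarrow> (real \<Rightarrow> real) \<Rightarrow> real" where
  "mollifier_moment j \<phi> = (LINT \<tau>|lborel. \<tau> ^ j * \<phi> \<tau>)"

definition moment_coeff :: "(real \<Rightarrow> real) \<Rightarrow> nat \<Rightarrow> real" where
  "moment_coeff \<phi> j = (- 1) ^ j * mollifier_moment j \<phi>"

end

theory Submission
  imports Defs "HOL-Probability.Sinc_Integral"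
begin

text \<open>
  Rotating the plane by \<open>\<theta>\<close> preserves area and carries the vertical line with abscissa \<open>q\<close> onto
  the line \<open>\<langle>x, \<omega>\<rangle> = q\<close>.  In the rotated coordinates Fubini's theorem has two consequences.  First,
  \<open>\<integral> Rf(\<theta>, q) q\<^sup>k dq\<close> is the integral of \<open>\<langle>x, \<omega>\<rangle>\<^sup>k f(x)\<close> over the plane, which converges for
  every \<open>k\<close> because \<open>f\<close> decays rapidly.  Second, \<open>\<chi>(x; \<theta>, p)\<close> depends on \<open>x\<close> only through
  \<open>q = \<langle>x, \<omega>\<rangle>\<close>, so that the modified transform is a one-dimensional smoothing of the usual one:
  \<open>\<integral> \<phi>(q - p) Rf(\<theta>, q) dq\<close>.

  The theorem is then a statement about functions of one variable.  In
  \<open>\<integral> p\<^sup>k \<integral> \<phi>(q - p) g(q) dq dp\<close> one exchanges the integrals and substitutes \<open>p = q - \<tau>\<close>; expanding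
  \<open>(q - \<tau>)\<^sup>k\<close> by the binomial theorem leaves the moments of \<open>g\<close> multiplied by those of \<open>\<phi>\<close>,
  the sign of \<open>\<tau>\<^sup>j\<close> being the one in \<open>c\<^sub>j\<close>.
\<close>

section \<open>Rotations preserve area\<close>

definition rotate_plane :: "real \<Rightarrow> real \<times> real \<Rightarrow> real \<times> real" where
  "rotate_plane \<theta> z = (fst z * cos \<theta> - snd z * sin \<theta>, fst z * sin \<theta> + snd z * cos \<theta>)"

lemma rotate_plane_measurable [measurable]: "rotate_plane \<theta> \<in> borel_measurable borel"
  unfolding rotate_plane_def [abs_def] borel_prod [symmetric] by measurable

lemma rotate_plane_inner_omega: "rotate_plane \<theta> z \<bullet> omega \<theta> = fst z"
proof -
  have "rotate_plane \<theta> z \<bullet> omega \<theta> = fst z * ((sin \<theta>)\<^sup>2 + (cos \<theta>)\<^sup>2)"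
    by (simp add: rotate_plane_def omega_def inner_prod_def algebra_simps power2_eq_square
        del: sin_cos_squared_add sin_cos_squared_add2 sin_cos_squared_add3)
  then show ?thesis by simp
qed

text \<open>If \<open>cos \<theta> \<noteq> 0\<close>, a rotation is a shear in one coordinate followed by a shear in the other, up to
  two scalings whose factors cancel; each of them is an affine substitution in one variable.
  If \<open>cos \<theta> = 0\<close>, it exchanges the coordinates up to signs.\<close>

lemma nn_integral_rotate_plane:
  fixes g :: "real \<times> real \<Rightarrow> ennreal"
  assumes [measurable]: "g \<in> borel_measurable borel"
  shows "(\<integral>\<^sup>+z. g (rotate_plane \<theta> z) \<partial>lborel) = (\<integral>\<^sup>+z. g z \<partial>lborel)"
proof -
  define c s where "c = cos \<theta>" and "s = sin \<theta>"
  have cs: "c * c + s * s = 1"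
    unfolding c_def s_def using sin_cos_squared_add3 by blast
  have [measurable]: "g \<in> borel_measurable (borel \<Otimes>\<^sub>M borel)"
    by (simp add: borel_prod)
  have target: "(\<integral>\<^sup>+z. g (rotate_plane \<theta> z) \<partial>lborel)
      = (\<integral>\<^sup>+t. \<integral>\<^sup>+p. g (p * c - t * s, p * s + t * c) \<partial>lborel \<partial>lborel)"
    by (simp add: lborel_prod [symmetric] lborel_pair.nn_integral_snd [symmetric]
        rotate_plane_def c_def s_def)
  have source: "(\<integral>\<^sup>+z. g z \<partial>lborel) = (\<integral>\<^sup>+u. \<integral>\<^sup>+v. g (u, v) \<partial>lborel \<partial>lborel)"
    by (simp add: lborel_prod [symmetric] lborel.nn_integral_fst)
  have swap: "(\<integral>\<^sup>+u. \<integral>\<^sup>+v. h u v \<partial>lborel \<partial>lborel) = (\<integral>\<^sup>+v. \<integral>\<^sup>+u. h u v \<partial>lborel \<partial>lborel)"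
    if "case_prod h \<in> borel_measurable (borel \<Otimes>\<^sub>M borel)" for h :: "real \<Rightarrow> real \<Rightarrow> ennreal"
    using lborel_pair.Fubini' [of h] that by simp
  show ?thesis
  proof (cases "c = 0")
    case True
    then have s: "s * s = 1" "s \<noteq> 0" "\<bar>s\<bar> = 1"
      using cs by (auto simp: square_eq_1_iff)
    have "(\<integral>\<^sup>+u. \<integral>\<^sup>+v. g (u, v) \<partial>lborel \<partial>lborel)
        = \<bar>-s\<bar> * (\<integral>\<^sup>+t. \<integral>\<^sup>+v. g (0 + (-s) * t, v) \<partial>lborel \<partial>lborel)"
      by (rule nn_integral_real_affine) (use s in auto)
    also have "\<dots> = (\<integral>\<^sup>+t. \<integral>\<^sup>+v. g (- (t * s), v) \<partial>lborel \<partial>lborel)"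
      using s by (simp add: mult.commute)
    also have "\<dots> = (\<integral>\<^sup>+t. \<bar>s\<bar> * (\<integral>\<^sup>+p. g (- (t * s), 0 + s * p) \<partial>lborel) \<partial>lborel)"
      by (rule nn_integral_cong, rule nn_integral_real_affine) (use s in auto)
    also have "\<dots> = (\<integral>\<^sup>+t. \<integral>\<^sup>+p. g (p * c - t * s, p * s + t * c) \<partial>lborel \<partial>lborel)"
      using s True by (simp add: mult.commute)
    finally show ?thesis
      by (simp add: target source)
  next
    case False
    have pos: "\<bar>1/c\<bar> * \<bar>c\<bar> = 1"
      using False by (simp add: abs_mult [symmetric])
    have alg: "(p * c - t * s) * s / c + t / c = p * s + t * c" for p t
    proof -
      have "(p * c - t * s) * s + t = (p * s + t * c) * c + t * (1 - (c * c + s * s))"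
        by (simp add: algebra_simps)
      then show ?thesis
        using False cs by (simp add: field_simps)
    qed
    have "(\<integral>\<^sup>+u. \<integral>\<^sup>+v. g (u, v) \<partial>lborel \<partial>lborel)
        = (\<integral>\<^sup>+u. \<bar>1/c\<bar> * (\<integral>\<^sup>+t. g (u, u * s / c + 1 / c * t) \<partial>lborel) \<partial>lborel)"
      by (rule nn_integral_cong, rule nn_integral_real_affine) (use False in auto)
    also have "\<dots> = \<bar>1/c\<bar> * (\<integral>\<^sup>+u. \<integral>\<^sup>+t. g (u, u * s / c + 1 / c * t) \<partial>lborel \<partial>lborel)"
      by (rule nn_integral_cmult) auto
    also have "(\<integral>\<^sup>+u. \<integral>\<^sup>+t. g (u, u * s / c + 1 / c * t) \<partial>lborel \<partial>lborel)
        = (\<integral>\<^sup>+t. \<integral>\<^sup>+u. g (u, u * s / c + 1 / c * t) \<partial>lborel \<partial>lborel)"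
      by (rule swap) measurable
    also have "\<dots> = (\<integral>\<^sup>+t. \<bar>c\<bar> * (\<integral>\<^sup>+p. g (- (t * s) + c * p,
        (- (t * s) + c * p) * s / c + 1 / c * t) \<partial>lborel) \<partial>lborel)"
      by (rule nn_integral_cong, rule nn_integral_real_affine) (use False in auto)
    also have "\<dots> = (\<integral>\<^sup>+t. \<bar>c\<bar> * (\<integral>\<^sup>+p. g (p * c - t * s, p * s + t * c) \<partial>lborel) \<partial>lborel)"
      by (simp add: alg [symmetric] mult.commute)
    also have "\<dots> = \<bar>c\<bar> * (\<integral>\<^sup>+t. \<integral>\<^sup>+p. g (p * c - t * s, p * s + t * c) \<partial>lborel \<partial>lborel)"
      by (rule nn_integral_cmult) auto
    finally show ?thesis
      by (simp add: target source mult.assoc [symmetric] ennreal_mult [symmetric] pos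
          del: abs_divide)
  qed
qed

lemma distr_rotate_plane: "distr lborel borel (rotate_plane \<theta>) = lborel"
proof (rule measure_eqI)
  fix A assume "A \<in> sets (distr lborel borel (rotate_plane \<theta>))"
  then have A [measurable]: "A \<in> sets borel" by simp
  have "emeasure (distr lborel borel (rotate_plane \<theta>)) A
      = (\<integral>\<^sup>+z. indicator A z \<partial>distr lborel borel (rotate_plane \<theta>))"
    by simp
  also have "\<dots> = (\<integral>\<^sup>+z. indicator A (rotate_plane \<theta> z) \<partial>lborel)"
    by (rule nn_integral_distr) auto
  also have "\<dots> = emeasure lborel A"
    by (subst nn_integral_rotate_plane) auto
  finally show "emeasure (distr lborel borel (rotate_plane \<theta>)) A = emeasure lborel A" .
qed simp

lemma integrable_rotate_plane:
  fixes g :: "real \<times> real \<Rightarrow> complex"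
  assumes "integrable lborel g"
  shows "integrable lborel (\<lambda>z. g (rotate_plane \<theta> z))"
proof (rule integrable_distr [of "rotate_plane \<theta>" lborel borel])
  show "rotate_plane \<theta> \<in> lborel \<rightarrow>\<^sub>M borel" by simp
  show "integrable (distr lborel borel (rotate_plane \<theta>)) g"
    using assms by (simp only: distr_rotate_plane)
qed

lemma integral_rotate_plane:
  fixes g :: "real \<times> real \<Rightarrow> complex"
  assumes [measurable]: "g \<in> borel_measurable borel"
  shows "(LINT z|lborel. g (rotate_plane \<theta> z)) = (LINT z|lborel. g z)"
  using integral_distr [of "rotate_plane \<theta>" lborel borel g] by (simp add: distr_rotate_plane)


section \<open>Integrability of Schwartz functions and of mollifiers\<close>

lemma smooth_continuous: "smooth f \<Longrightarrow> continuous_on UNIV f"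
  unfolding smooth_def by (drule spec [of _ "[]"]) (auto intro: differentiable_imp_continuous_on)

lemma integrable_inverse_1_plus_square_real:
  "integrable lborel (\<lambda>x::real. inverse (1 + x\<^sup>2))"
  using integrable_inverse_1_plus_square by (simp add: set_integrable_def)

lemma integrable_lborel_product:
  fixes g h :: "real \<Rightarrow> 'a::{real_normed_field, banach, second_countable_topology}"
  assumes g: "integrable lborel g" and h: "integrable lborel h"
  shows "integrable lborel (\<lambda>(x, y). g x * h y)"
proof -
  have [measurable]: "g \<in> borel_measurable borel" "h \<in> borel_measurable borel"
    using g h by auto
  have "integrable (lborel \<Otimes>\<^sub>M lborel) (\<lambda>(x, y). g x * h y)"
    by (rule lborel_pair.Fubini_integrable) (use g h in \<open>auto simp: norm_mult\<close>)
  then show ?thesis by (simp add: lborel_prod)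
qed

lemma schwartz_monomial_bounded:
  fixes f :: "real \<times> real \<Rightarrow> complex"
  assumes "f \<in> schwartz_space"
  obtains B where "\<And>x y. \<bar>x\<bar> ^ i * \<bar>y\<bar> ^ j * norm (f (x, y)) \<le> B"
proof -
  define \<alpha> where "\<alpha> b = (if b = (1, 0 :: real) then i else j)" for b :: "real \<times> real"
  have "bounded (range (\<lambda>z. (\<Prod>b\<in>Basis. (z \<bullet> b) ^ \<alpha> b) *\<^sub>R partials [] f z))"
    using assms unfolding schwartz_space_def by (auto simp del: partials.simps)
  then obtain B where B: "\<And>z. norm ((\<Prod>b\<in>Basis. (z \<bullet> b) ^ \<alpha> b) *\<^sub>R f z) \<le> B"
    by (auto simp: bounded_iff)
  have basis: "(Basis :: (real \<times> real) set) = {(1, 0), (0, 1)}"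
    by (auto simp: Basis_prod_def)
  have "\<bar>x\<bar> ^ i * \<bar>y\<bar> ^ j * norm (f (x, y)) \<le> B" for x y
    using B [of "(x, y)"] by (simp add: basis \<alpha>_def abs_mult power_abs)
  then show ?thesis using that by blast
qed

text \<open>Multiplying by \<open>(1 + x\<^sup>2) (1 + y\<^sup>2)\<close> leaves a combination of four monomials times \<open>f\<close>, which is
  bounded; so the function decays at least like the integrable reciprocal of this weight.\<close>

lemma schwartz_monomial_integrable:
  fixes f :: "real \<times> real \<Rightarrow> complex"
  assumes f: "f \<in> schwartz_space"
  shows "integrable lborel (\<lambda>z. of_real (fst z ^ i * snd z ^ j) * f z)"
proof -
  have cont: "continuous_on UNIV f"
    using f by (auto simp: schwartz_space_def intro: smooth_continuous)
  obtain B1 where B1: "\<And>x y. \<bar>x\<bar> ^ i * \<bar>y\<bar> ^ j * norm (f (x, y)) \<le> B1"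
    using schwartz_monomial_bounded [OF f, of i j] by blast
  obtain B2 where B2: "\<And>x y. \<bar>x\<bar> ^ (i + 2) * \<bar>y\<bar> ^ j * norm (f (x, y)) \<le> B2"
    using schwartz_monomial_bounded [OF f, of "i + 2" j] by blast
  obtain B3 where B3: "\<And>x y. \<bar>x\<bar> ^ i * \<bar>y\<bar> ^ (j + 2) * norm (f (x, y)) \<le> B3"
    using schwartz_monomial_bounded [OF f, of i "j + 2"] by blast
  obtain B4 where B4: "\<And>x y. \<bar>x\<bar> ^ (i + 2) * \<bar>y\<bar> ^ (j + 2) * norm (f (x, y)) \<le> B4"
    using schwartz_monomial_bounded [OF f, of "i + 2" "j + 2"] by blast
  define B where "B = B1 + B2 + B3 + B4"
  have weighted: "\<bar>x\<bar> ^ i * \<bar>y\<bar> ^ j * norm (f (x, y)) * ((1 + x\<^sup>2) * (1 + y\<^sup>2)) \<le> B" for x y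
  proof -
    have square: "\<bar>u\<bar> ^ (n + 2) = \<bar>u\<bar> ^ n * u\<^sup>2" for u :: real and n
      by (simp add: power_add power2_eq_square)
    show ?thesis
      using B1 [of x y] B2 [of x y] B3 [of x y] B4 [of x y]
      unfolding B_def square by (simp add: algebra_simps)
  qed
  have "integrable lborel (\<lambda>z. B * (case z of (x, y) \<Rightarrow> inverse (1 + x\<^sup>2) * inverse (1 + y\<^sup>2)))"
    by (intro integrable_mult_right integrable_lborel_product
        integrable_inverse_1_plus_square_real)
  then show ?thesis
  proof (rule Bochner_Integration.integrable_bound)
    have "continuous_on UNIV (\<lambda>z. of_real (fst z ^ i * snd z ^ j) * f z)"
      by (intro continuous_intros cont)
    then show "(\<lambda>z. of_real (fst z ^ i * snd z ^ j) * f z) \<in> borel_measurable lborel"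
      by (simp add: borel_measurable_continuous_onI)
    have "norm (of_real (x ^ i * y ^ j) * f (x, y))
        \<le> norm (B * (inverse (1 + x\<^sup>2) * inverse (1 + y\<^sup>2)))" for x y
    proof -
      have "0 < (1 + x\<^sup>2) * (1 + y\<^sup>2)"
        by (intro mult_pos_pos add_pos_nonneg) auto
      then have "\<bar>x\<bar> ^ i * \<bar>y\<bar> ^ j * norm (f (x, y)) \<le> B / ((1 + x\<^sup>2) * (1 + y\<^sup>2))"
        using weighted [of x y] by (simp add: pos_le_divide_eq)
      also have "\<dots> = B * (inverse (1 + x\<^sup>2) * inverse (1 + y\<^sup>2))"
        by (simp add: divide_inverse)
      also have "\<dots> \<le> norm (B * (inverse (1 + x\<^sup>2) * inverse (1 + y\<^sup>2)))"
        by (simp only: real_norm_def abs_ge_self)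
      finally show ?thesis
        by (simp add: norm_mult norm_power abs_mult power_abs)
    qed
    then show "AE z in lborel. norm (of_real (fst z ^ i * snd z ^ j) * f z)
        \<le> norm (B * (case z of (x, y) \<Rightarrow> inverse (1 + x\<^sup>2) * inverse (1 + y\<^sup>2)))"
      by auto
  qed
qed

lemma schwartz_inner_power_integrable:
  fixes f :: "real \<times> real \<Rightarrow> complex"
  assumes f: "f \<in> schwartz_space"
  shows "integrable lborel (\<lambda>z. of_real ((z \<bullet> w) ^ k) * f z)"
proof -
  have "of_real ((z \<bullet> w) ^ k) * f z = (\<Sum>i\<le>k. of_real (of_nat (k choose i) * fst w ^ i * snd w ^ (k - i))
      * (of_real (fst z ^ i * snd z ^ (k - i)) * f z))" for z
    by (simp add: inner_prod_def binomial_ring sum_distrib_right power_mult_distrib sum_distrib_left mult_ac)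
  then show ?thesis
    by (simp only:) (intro Bochner_Integration.integrable_sum integrable_mult_right
        schwartz_monomial_integrable f)
qed

lemma continuous_compact_support_integrable:
  fixes h :: "'a::euclidean_space \<Rightarrow> 'b::{banach, second_countable_topology}"
  assumes "continuous_on UNIV h" and "compact S" and "\<And>x. x \<notin> S \<Longrightarrow> h x = 0"
  shows "integrable lborel h"
proof -
  have "integrable lborel (\<lambda>x. indicator S x *\<^sub>R h x)"
    using assms by (intro borel_integrable_compact) (auto intro: continuous_on_subset)
  also have "(\<lambda>x. indicator S x *\<^sub>R h x) = h"
    using assms(3) by (auto simp: indicator_def)
  finally show ?thesis .
qed

lemma positive_mollifier_moment_integrable:
  assumes "positive_mollifier \<phi>"
  shows "integrable lborel (\<lambda>t. t ^ j * \<phi> t)"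
proof (rule continuous_compact_support_integrable)
  show "compact (closure {t. \<phi> t \<noteq> 0})"
    using assms by (simp add: positive_mollifier_def)
  show "continuous_on UNIV (\<lambda>t. t ^ j * \<phi> t)"
    using assms by (intro continuous_intros smooth_continuous) (simp add: positive_mollifier_def)
  show "t ^ j * \<phi> t = 0" if "t \<notin> closure {t. \<phi> t \<noteq> 0}" for t
    using that closure_subset [of "{t. \<phi> t \<noteq> 0}"] by auto
qed

lemma positive_mollifier_bounded:
  assumes "positive_mollifier \<phi>"
  obtains M where "\<And>t. \<bar>\<phi> t\<bar> \<le> M"
proof -
  let ?S = "closure {t. \<phi> t \<noteq> 0}"
  have "compact (\<phi> ` ?S)"
    using assms by (intro compact_continuous_image continuous_on_subset [OF smooth_continuous])
      (auto simp: positive_mollifier_def)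
  then obtain M where M: "\<And>t. t \<in> ?S \<Longrightarrow> \<bar>\<phi> t\<bar> \<le> M"
    by (auto dest!: compact_imp_bounded simp: bounded_iff) blast
  have "\<bar>\<phi> t\<bar> \<le> max 0 M" for t
    using M [of t] closure_subset [of "{t. \<phi> t \<noteq> 0}"] by (cases "\<phi> t = 0") auto
  then show ?thesis using that by blast
qed


section \<open>The Radon transform in rotated coordinates\<close>

lemma radon_eq_rotate_plane:
  assumes f: "f \<in> borel_measurable borel"
  shows "radon f \<theta> q = (LINT t|lborel. f (rotate_plane \<theta> (q, t)))"
proof -
  have line: "q *\<^sub>R omega \<theta> + t *\<^sub>R (- sin \<theta>, cos \<theta>) = rotate_plane \<theta> (q, t)" for t
    by (simp add: omega_def rotate_plane_def)
  have [measurable]: "(\<lambda>t. rotate_plane \<theta> (q, t)) \<in> borel_measurable borel"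
    by measurable
  have [measurable]: "{x :: real \<times> real. x \<bullet> omega \<theta> = q} \<in> sets borel"
    by (intro borel_closed closed_Collect_eq continuous_intros)
  note [measurable] = f
  show ?thesis
    unfolding radon_def set_lebesgue_integral_def line_arc_length_def line
    by (subst integral_distr) (auto simp: rotate_plane_inner_omega)
qed

lemma radon_moment_integrable:
  assumes f: "f \<in> schwartz_space"
  shows "integrable lborel (\<lambda>q. radon f \<theta> q * of_real (q ^ k))"
proof -
  have meas: "f \<in> borel_measurable borel"
    using f by (auto simp: schwartz_space_def intro: borel_measurable_continuous_onI smooth_continuous)
  have "integrable lborel (\<lambda>z. of_real (fst z ^ k) * f (rotate_plane \<theta> z))"
    using integrable_rotate_plane [OF schwartz_inner_power_integrable [OF f, of "omega \<theta>" k], of \<theta>]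
    by (simp only: rotate_plane_inner_omega)
  then have "integrable (lborel \<Otimes>\<^sub>M lborel) (\<lambda>(q, t). of_real (q ^ k) * f (rotate_plane \<theta> (q, t)))"
    by (simp add: lborel_prod case_prod_unfold)
  then have "integrable lborel (\<lambda>q. LINT t|lborel. of_real (q ^ k) * f (rotate_plane \<theta> (q, t)))"
    by (rule lborel_pair.integrable_fst)
  then show ?thesis
    by (simp add: radon_eq_rotate_plane [OF meas] mult.commute)
qed

text \<open>The weight \<open>\<chi>(x; \<theta>, p)\<close> is constant along each line \<open>\<langle>x, \<omega>\<rangle> = q\<close>, so the integral over the
  plane can be taken along these lines first.\<close>

lemma modified_radon_eq_smoothed_radon:
  assumes \<phi>: "positive_mollifier \<phi>" and f: "f \<in> schwartz_space"
  shows "modified_radon \<phi> f \<theta> p = (LINT q|lborel. of_real (\<phi> (q - p)) * radon f \<theta> q)"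
proof -
  have f_meas [measurable]: "f \<in> borel_measurable borel"
    using f by (auto simp: schwartz_space_def intro: borel_measurable_continuous_onI smooth_continuous)
  have [measurable]: "\<phi> \<in> borel_measurable borel"
    using \<phi> by (auto simp: positive_mollifier_def intro: borel_measurable_continuous_onI smooth_continuous)
  have [measurable]: "(fst :: real \<times> real \<Rightarrow> real) \<in> borel_measurable borel"
    unfolding borel_prod [symmetric] by measurable
  obtain M where M: "\<And>t. \<bar>\<phi> t\<bar> \<le> M"
    using positive_mollifier_bounded [OF \<phi>] by blast
  have "integrable lborel (\<lambda>z. of_real ((z \<bullet> omega \<theta>) ^ 0) * f z)"
    by (rule schwartz_inner_power_integrable [OF f])
  then have "integrable lborel f" by simp
  then have int_rot: "integrable lborel (\<lambda>z. f (rotate_plane \<theta> z))"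
    by (rule integrable_rotate_plane)
  have "integrable lborel (\<lambda>z. of_real (\<phi> (fst z - p)) * f (rotate_plane \<theta> z))"
  proof (rule Bochner_Integration.integrable_bound [OF integrable_mult_right [OF int_rot]])
    show "AE z in lborel. norm (of_real (\<phi> (fst z - p)) * f (rotate_plane \<theta> z))
        \<le> norm (of_real M * f (rotate_plane \<theta> z))"
      using M by (intro AE_I2) (auto simp: norm_mult intro!: mult_right_mono order_trans [OF M])
  qed measurable
  then have int: "integrable (lborel \<Otimes>\<^sub>M lborel)
      (\<lambda>(q, t). of_real (\<phi> (q - p)) * f (rotate_plane \<theta> (q, t)))"
    by (simp add: lborel_prod case_prod_unfold)
  have "modified_radon \<phi> f \<theta> p
      = (LINT z|lborel. of_real (\<phi> (rotate_plane \<theta> z \<bullet> omega \<theta> - p)) * f (rotate_plane \<theta> z))"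
    unfolding modified_radon_def chi_def
    by (rule integral_rotate_plane [symmetric]) measurable
  also have "\<dots> = (LINT z|(lborel \<Otimes>\<^sub>M lborel).
      (case z of (q, t) \<Rightarrow> of_real (\<phi> (q - p)) * f (rotate_plane \<theta> (q, t))))"
    by (simp add: rotate_plane_inner_omega lborel_prod case_prod_unfold)
  also have "\<dots> = (LINT q|lborel. LINT t|lborel. of_real (\<phi> (q - p)) * f (rotate_plane \<theta> (q, t)))"
    using lborel_pair.integral_fst [OF int] by simp
  finally show ?thesis
    by (simp add: radon_eq_rotate_plane [OF f_meas])
qed


section \<open>Moments of a smoothed function of one variable\<close>

text \<open>For fixed \<open>q\<close>, the substitution \<open>p = q - \<tau>\<close> turns the inner integral into one of
  \<open>(q - \<tau>)\<^sup>k \<phi>(\<tau>) g(q)\<close>, whose binomial expansion consists of products of a function of \<open>q\<close> and a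
  function of \<open>\<tau>\<close>.  The integrability of these products is what justifies exchanging the
  integrals.\<close>

lemma smoothed_moment:
  fixes g :: "real \<Rightarrow> complex" and \<phi> :: "real \<Rightarrow> real"
  assumes \<phi>: "\<And>j. integrable lborel (\<lambda>t. t ^ j * \<phi> t)"
    and g: "\<And>j. integrable lborel (\<lambda>q. g q * of_real (q ^ j))"
  shows "integrable lborel (\<lambda>p. (LINT q|lborel. of_real (\<phi> (q - p)) * g q) * of_real (p ^ k))"
      (is "?integrable")
    and "(LINT p|lborel. (LINT q|lborel. of_real (\<phi> (q - p)) * g q) * of_real (p ^ k)) =
      (\<Sum>j\<le>k. of_nat (k choose j) * of_real (moment_coeff \<phi> j) *
        (LINT q|lborel. g q * of_real (q ^ (k - j))))" (is "?moment")
proof -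
  have [measurable]: "g \<in> borel_measurable borel" "\<phi> \<in> borel_measurable borel"
    using g [of 0] \<phi> [of 0] by auto
  define H where "H q \<tau> = of_real ((q - \<tau>) ^ k * \<phi> \<tau>) * g q" for q \<tau>
  define K where "K q p = of_real (\<phi> (q - p)) * g q * of_real (p ^ k)" for q p
  have K_H: "K q p = H q (q - p)" for q p
    by (simp add: K_def H_def)
  have H_expand: "H q \<tau> = (\<Sum>j\<le>k. of_nat (k choose j) *
      (g q * of_real (q ^ (k - j)) * of_real ((- 1) ^ j * (\<tau> ^ j * \<phi> \<tau>))))" for q \<tau>
  proof -
    have "(q - \<tau>) ^ k = (- \<tau> + q) ^ k" by simp
    also have "\<dots> = (\<Sum>j\<le>k. of_nat (k choose j) * ((- 1) ^ j * \<tau> ^ j) * q ^ (k - j))"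
      unfolding binomial_ring by (simp add: power_minus [of \<tau>])
    finally show ?thesis
      by (simp add: H_def sum_distrib_left sum_distrib_right mult_ac)
  qed
  have \<phi>_int: "integrable lborel (\<lambda>\<tau>. complex_of_real ((- 1) ^ j * (\<tau> ^ j * \<phi> \<tau>)))" for j
    by (intro integrable_of_real integrable_mult_right \<phi>)
  have H_int: "integrable (lborel \<Otimes>\<^sub>M lborel) (\<lambda>(q, \<tau>). H q \<tau>)"
  proof -
    have "integrable lborel (\<lambda>z. \<Sum>j\<le>k. of_nat (k choose j) * (case z of (q, \<tau>) \<Rightarrow>
        (g q * of_real (q ^ (k - j))) * of_real ((- 1) ^ j * (\<tau> ^ j * \<phi> \<tau>))))"
      by (intro Bochner_Integration.integrable_sum integrable_mult_right
          integrable_lborel_product g \<phi>_int)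
    then show ?thesis
      by (simp add: H_expand lborel_prod case_prod_unfold)
  qed
  have H_inner: "integrable lborel (H q)" for q
    unfolding H_expand [abs_def]
    by (intro Bochner_Integration.integrable_sum integrable_mult_right \<phi>_int)
  have K_int: "integrable (lborel \<Otimes>\<^sub>M lborel) (\<lambda>(q, p). K q p)"
  proof (rule lborel_pair.Fubini_integrable)
    show "(\<lambda>(q, p). K q p) \<in> borel_measurable (lborel \<Otimes>\<^sub>M lborel)"
      unfolding K_def by measurable
    show "AE q in lborel. integrable lborel (\<lambda>p. case (q, p) of (q, p) \<Rightarrow> K q p)"
      using lborel_integrable_real_affine [OF H_inner, of "- 1"] by (simp add: K_H)
    have "(LINT p|lborel. norm (K q p)) = (LINT \<tau>|lborel. norm (H q \<tau>))" for q
      using lborel_integral_real_affine [of "- 1" "\<lambda>\<tau>. norm (H q \<tau>)" q] by (simp add: K_H)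
    moreover have "integrable lborel (\<lambda>q. LINT \<tau>|lborel. norm (H q \<tau>))"
      using integrable_norm [OF H_int] by (intro lborel_pair.integrable_fst) (simp add: case_prod_unfold)
    ultimately show "integrable lborel (\<lambda>q. LINT p|lborel. norm (case (q, p) of (q, p) \<Rightarrow> K q p))"
      by simp
  qed
  have outer: "(LINT q|lborel. of_real (\<phi> (q - p)) * g q) * of_real (p ^ k) = (LINT q|lborel. K q p)" for p
    by (simp add: K_def)
  show ?integrable
    unfolding outer by (rule lborel_pair.integrable_snd [OF K_int])
  have K_inner: "(LINT p|lborel. K q p) = (\<Sum>j\<le>k. of_nat (k choose j) *
      (g q * of_real (q ^ (k - j)) * of_real (moment_coeff \<phi> j)))" for q
  proof -
    have "(LINT p|lborel. K q p) = (LINT \<tau>|lborel. H q \<tau>)"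
      using lborel_integral_real_affine [of "- 1" "H q" q] by (simp add: K_H)
    also have "\<dots> = (\<Sum>j\<le>k. of_nat (k choose j) * (g q * of_real (q ^ (k - j)) *
        (LINT \<tau>|lborel. of_real ((- 1) ^ j * (\<tau> ^ j * \<phi> \<tau>)))))"
      unfolding H_expand
      by (subst Bochner_Integration.integral_sum)
        (intro integrable_mult_right \<phi>_int, simp only: integral_mult_right_zero)
    also have "\<dots> = (\<Sum>j\<le>k. of_nat (k choose j) *
        (g q * of_real (q ^ (k - j)) * of_real (moment_coeff \<phi> j)))"
      by (simp only: integral_complex_of_real integral_mult_right_zero
          moment_coeff_def mollifier_moment_def)
    finally show ?thesis .
  qed
  have "(LINT p|lborel. LINT q|lborel. K q p) = (LINT q|lborel. LINT p|lborel. K q p)"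
    by (rule lborel_pair.Fubini_integral [OF K_int])
  also have "\<dots> = (\<Sum>j\<le>k. LINT q|lborel. of_nat (k choose j) *
      (g q * of_real (q ^ (k - j)) * of_real (moment_coeff \<phi> j)))"
    unfolding K_inner
    by (intro Bochner_Integration.integral_sum integrable_mult_right integrable_mult_left g)
  also have "\<dots> = (\<Sum>j\<le>k. of_nat (k choose j) * of_real (moment_coeff \<phi> j) *
      (LINT q|lborel. g q * of_real (q ^ (k - j))))"
    by (simp only: integral_mult_right_zero integral_mult_left_zero) (simp only: mult_ac)
  finally show ?moment
    by (simp only: outer)
qed


section \<open>Moments of the modified Radon transform\<close>

theorem theorem4p1:
  fixes \<phi> :: "real \<Rightarrow> real" and f :: "real \<times> real \<Rightarrow> complex" and k :: nat and \<theta> :: real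
  assumes "\<phi> \<in> Omega"
    and "f \<in> schwartz_space"
    and "\<theta> \<in> {0..2 * pi}"
  shows "integrable lborel (\<lambda>p. modified_radon \<phi> f \<theta> p * of_real (p ^ k)) \<and>
    radon_moment (modified_radon \<phi> f) k \<theta> =
      (\<Sum>j=0..k. of_nat (k choose j) * of_real (moment_coeff \<phi> j) * radon_moment (radon f) (k - j) \<theta>)"
proof -
  have \<phi>: "positive_mollifier \<phi>"
    using assms(1) by (simp add: Omega_def symmetric_mollifier_def)
  note moments = smoothed_moment [of \<phi> "radon f \<theta>" k,
      OF positive_mollifier_moment_integrable [OF \<phi>] radon_moment_integrable [OF assms(2)]]
  show ?thesis
    unfolding radon_moment_def modified_radon_eq_smoothed_radon [OF \<phi> assms(2)] atLeast0AtMost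
    using moments by (rule conjI)
qed

end
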